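(* Let $n\ge1$ and let $\pi$ be a permutation of $\{1,\dots,n\}$. Put $$D_\pi=\sum_{i=1}^n|i-\pi(i)|,\quad S_\pi=\sum_{i=1}^n(i-\pi(i))^2,\quad m_\pi=\frac{D_\pi}{n^2},\quad q_\pi=\frac{S_\pi}{n^3}.$$ Then $$m_\pi^2+V_{\min}(m_\pi)\le q_\pi\le m_\pi^2+V_{\max}(m_\pi)=\frac{1-(1-2m_\pi)^{3/2}}{3}.$$
   Context: For $m\in[0,\tfrac12]$ define $V_{\max}(m)=\frac{1-(1-2m)^{3/2}}{3}-m^2$. Define $V_{\min}(0)=0$ and, for $m\in(0,\tfrac12]$, choose the integer $N\ge1$ with $m\in(\tfrac1{2N+2},\tfrac1{2N}]$, let $\ell\in\{\tfrac1{2N+2},\tfrac1{2N}\}$ be an endpoint nearest to $m$, put $\Delta_m=|m-\ell|$, and set $$V_{\min}(m)=\frac{2\Delta_m^{3/2}}{3\sqrt{N(N+1)}}-\Delta_m^2.$$ (One has $m_\pi\in[0,\tfrac12]$ for every permutation $\pi$.) *)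

theory Defs
  imports Complex_Main "HOL-Combinatorics.Permutations"
begin

definition D_perm :: "nat \<Rightarrow> (nat \<Rightarrow> nat) \<Rightarrow> int" where
  "D_perm n p = (\<Sum>i=1..n. \<bar>int i - int (p i)\<bar>)"

definition S_perm :: "nat \<Rightarrow> (nat \<Rightarrow> nat) \<Rightarrow> int" where
  "S_perm n p = (\<Sum>i=1..n. (int i - int (p i))\<^sup>2)"

definition m_perm :: "nat \<Rightarrow> (nat \<Rightarrow> nat) \<Rightarrow> real" where
  "m_perm n p = real_of_int (D_perm n p) / real n ^ 2"

definition q_perm :: "nat \<Rightarrow> (nat \<Rightarrow> nat) \<Rightarrow> real" where
  "q_perm n p = real_of_int (S_perm n p) / real n ^ 3"

text \<open>The functions below are meaningful on the interval from 0 to 1/2 only; their values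
  elsewhere are irrelevant, since the normalised displacement of a permutation always lies in
  that interval.\<close>

definition V_max :: "real \<Rightarrow> real" where
  "V_max m = (1 - (1 - 2 * m) powr (3/2)) / 3 - m\<^sup>2"

definition N_of :: "real \<Rightarrow> nat" where
  "N_of m = (THE N. 1 \<le> N \<and> m \<in> {1 / (2 * real N + 2) <.. 1 / (2 * real N)})"

definition nearest_endpoint :: "real \<Rightarrow> real" where
  "nearest_endpoint m =
     (ARG_MIN (\<lambda>l. \<bar>m - l\<bar>) l. l \<in> {1 / (2 * real (N_of m) + 2), 1 / (2 * real (N_of m))})"

definition Delta :: "real \<Rightarrow> real" where
  "Delta m = \<bar>m - nearest_endpoint m\<bar>"

definition V_min :: "real \<Rightarrow> real" where
  "V_min m =
     (if m = 0 then 0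
      else 2 * Delta m powr (3/2) / (3 * sqrt (real (N_of m) * (real (N_of m) + 1)))
             - (Delta m)\<^sup>2)"

lemma N_of_ex1:
  assumes "0 < m" and "m \<le> 1/2"
  shows "\<exists>!N::nat. 1 \<le> N \<and> m \<in> {1 / (2 * real N + 2) <.. 1 / (2 * real N)}"
proof -
  have *: "(1 \<le> N \<and> m \<in> {1 / (2 * real N + 2) <.. 1 / (2 * real N)}) \<longleftrightarrow>
        1 \<le> N \<and> int N = \<lfloor>1 / (2 * m)\<rfloor>" for N :: nat
    using assms(1) by (auto simp: eq_commute[of "int N"] floor_eq_iff field_simps)
  have "1 \<le> \<lfloor>1 / (2 * m)\<rfloor>"
    using assms by (simp add: field_simps)
  then show ?thesis
    unfolding * by (intro ex1I[of _ "nat \<lfloor>1 / (2 * m)\<rfloor>"]) linarith+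
qed

text \<open>At the midpoint of the interval both endpoints are nearest, but the distance does not
  depend on which one is chosen.\<close>

lemma Delta_eq_min:
  "Delta m = min \<bar>m - 1 / (2 * real (N_of m) + 2)\<bar> \<bar>m - 1 / (2 * real (N_of m))\<bar>"
proof -
  let ?A = "{1 / (2 * real (N_of m) + 2), 1 / (2 * real (N_of m))}"
  have "\<exists>l. is_arg_min (\<lambda>l. \<bar>m - l\<bar>) (\<lambda>l. l \<in> ?A) l"
    by (rule ex_is_arg_min_if_finite) auto
  then have "is_arg_min (\<lambda>l. \<bar>m - l\<bar>) (\<lambda>l. l \<in> ?A) (nearest_endpoint m)"
    unfolding nearest_endpoint_def arg_min_def by (rule someI_ex)
  then show ?thesis
    unfolding Delta_def is_arg_min_linorder by auto
qed

end

theory Submission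
  imports Defs "HOL-Analysis.Henstock_Kurzweil_Integration"
begin

text \<open>
  Both bounds come from weak linear programming duality for transport problems on the line. If
  \<open>f x + f y \<le> A * (x - y)\<^sup>2 + B * \<bar>x - y\<bar> + C\<close> on the unit square, then a permutation with moments \<open>m\<close>
  and \<open>q\<close> satisfies \<open>2 * \<integral>f \<le> A * q + B * m + C\<close> (lemma \<open>perm_quadratic_cost_ge\<close>). So \<open>q\<close> lies on one side
  of a line in \<open>m\<close>, and the proof consists in finding for each tangent line of the two extremal
  curves a potential \<open>f\<close> that certifies it.

  The upper curve has slope \<open>a = sqrt (1 - 2 * m)\<close>. Its extremal rearrangements fix a central interval
  of length \<open>a\<close> and reverse the rest; the corresponding potential is concave, and the
  required inequality is midpoint convexity of its negative (lemma \<open>q_perm_upper\<close>).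

  For the lower curve let the slope be \<open>2 * b\<close>, so that the cost to be bounded is \<open>(\<bar>x - y\<bar> - b)\<^sup>2\<close>. If
  \<open>b = 1 / (2 * k)\<close>, swapping consecutive blocks of length \<open>b\<close> costs nothing, which is why the variance
  bound vanishes there. In general \<open>b\<close> differs by some \<open>\<beta>\<close> from the nearest such value; in an optimal
  rearrangement some points still move by that value, and the remaining displacements fill
  \<open>[b - \<beta>, b + \<beta>]\<close>. Dually, the derivative of the potential at a matched point is \<open>\<plusminus> 2\<close> times the
  excess of the displacement over \<open>b\<close>, hence \<open>\<plusminus> 2 * \<beta>\<close> at points of the first kind: the potential is a
  \<open>2 * b\<close>-periodic zigzag whose corners are rounded to parabolas, wider at the valleys than at the
  peaks. Written as a function of the distance to the nearest valley (\<open>profile\<close>), the pointwise inequality on the line becomes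
  \<open>\<phi> s + \<phi> t \<le> (s + t - b)\<^sup>2\<close>, because shifting by \<open>b\<close> replaces that distance by its complement in \<open>b\<close>
  (\<open>lattice_dist_pair\<close>); and this is a matter of the elementary inequality
  \<open>u\<^sup>2 / (N + 1) \<le> (u - g)\<^sup>2 + g\<^sup>2 / N\<close> (\<open>pos_part_trade_off\<close>, \<open>profile_pair\<close>). The position of the zigzag in the
  unit interval is a parameter \<open>r\<close>, so that both sides of the nearest endpoint are covered by the
  same computation (\<open>q_perm_lower\<close>).
\<close>

section \<open>Powers of the positive part\<close>

lemma DERIV_pos_part_power:
  fixes g :: "real \<Rightarrow> real"
  assumes g: "(g has_real_derivative g') (at x within S)"
  shows "((\<lambda>x. max 0 (g x) ^ (k + 2)) has_real_derivative real (k + 2) * max 0 (g x) ^ (k + 1) * g')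
           (at x within S)"
proof -
  have "((\<lambda>y. max 0 y ^ (k + 2)) has_real_derivative real (k + 2) * max 0 y ^ (k + 1)) (at y)"
    for y :: real
  proof -
    consider "y < 0" | "y = 0" | "y > 0" by linarith
    then show ?thesis
    proof cases
      case 1
      have "((\<lambda>y. 0) has_real_derivative real (k + 2) * max 0 y ^ (k + 1)) (at y)"
        using 1 by simp
      then show ?thesis
        by (rule has_field_derivative_transform_within_open[of _ _ _ "{..<0}"]) (use 1 in auto)
    next
      case 2
      have "((\<lambda>h::real. max 0 h ^ (k + 1)) \<longlongrightarrow> max 0 0 ^ (k + 1)) (at 0)"
        by (intro tendsto_intros)
      moreover have "\<forall>\<^sub>F h in at (0::real). max 0 h ^ (k + 1) = (max 0 h ^ (k + 2)) / h"
        by (simp add: eventually_at_filter max_def)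
      ultimately have "((\<lambda>h::real. max 0 h ^ (k + 2) / h) \<longlongrightarrow> 0) (at 0)"
        by (auto elim: Lim_transform_eventually)
      then show ?thesis
        using 2 by (simp add: DERIV_def)
    next
      case 3
      have "((\<lambda>y. y ^ (k + 2)) has_real_derivative real (k + 2) * max 0 y ^ (k + 1)) (at y)"
        by (rule derivative_eq_intros refl)+ (use 3 in simp)
      then show ?thesis
        by (rule has_field_derivative_transform_within_open[of _ _ _ "{0<..}"]) (use 3 in auto)
    qed
  qed
  from DERIV_chain2[OF this g] show ?thesis by simp
qed

lemma DERIV_pos_part_square:
  fixes g :: "real \<Rightarrow> real"
  assumes "(g has_real_derivative g') (at x within S)" "D = 2 * max 0 (g x) * g'"
  shows "((\<lambda>x. (max 0 (g x))\<^sup>2) has_real_derivative D) (at x within S)"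
  using DERIV_pos_part_power[OF assms(1), of 0] assms(2) by (simp add: power2_eq_square)

lemma DERIV_pos_part_cube:
  fixes g :: "real \<Rightarrow> real"
  assumes "(g has_real_derivative g') (at x within S)" "D = 3 * (max 0 (g x))\<^sup>2 * g'"
  shows "((\<lambda>x. (max 0 (g x)) ^ 3) has_real_derivative D) (at x within S)"
  using DERIV_pos_part_power[OF assms(1), of 1] assms(2)
  by (simp add: numeral_eq_Suc)

section \<open>Duality for permutations\<close>

lemma sum_cell_integrals:
  fixes f :: "real \<Rightarrow> real"
  assumes f: "continuous_on {0..1} f" and "k \<le> n" "n > 0"
  shows "(\<Sum>i=1..k. integral {0..1 / real n} (\<lambda>t. f (t + (real i - 1) / real n)))
           = integral {0..real k / real n} f"
  using \<open>k \<le> n\<close>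
proof (induction k)
  case 0
  then show ?case by simp
next
  case (Suc k)
  have sub: "{a..real (Suc k) / real n} \<subseteq> {0..1}" if "a \<ge> 0" for a
    using Suc.prems \<open>n > 0\<close> that by (auto simp: divide_simps elim: order_trans)
  have cell: "integral {0..1 / real n} (\<lambda>t. f (t + real k / real n))
      = integral {real k / real n..real (Suc k) / real n} f"
    using integral_shift[of 0 "real k / real n" "1 / real n" f] continuous_on_subset[OF f sub]
    by (simp add: o_def add_divide_distrib)
  have "integral {0..real k / real n} f + integral {real k / real n..real (Suc k) / real n} f
      = integral {0..real (Suc k) / real n} f"
    by (intro integral_combine integrable_continuous_interval continuous_on_subset[OF f] sub)
       (auto simp: divide_right_mono)
  then show ?case
    using Suc cell by simp
qed

text \<open>Weak duality. Translating each cell \<open>[(i - 1)/n, i/n]\<close> onto the cell of \<open>p i\<close> turns the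
  permutation into a measure preserving map of the unit interval with constant displacement on
  each cell, so integrating the pointwise inequality along the graph of that map counts the
  integral of \<open>f\<close> twice and gives exactly the discrete moments: no quadrature error appears.\<close>

lemma perm_quadratic_cost_ge:
  fixes f :: "real \<Rightarrow> real"
  assumes "n \<ge> 1" and p: "p permutes {1..n}"
    and f: "continuous_on {0..1} f"
    and cost: "\<And>x y. 0 \<le> x \<Longrightarrow> x \<le> 1 \<Longrightarrow> 0 \<le> y \<Longrightarrow> y \<le> 1 \<Longrightarrow>
                 f x + f y \<le> A * (x - y)\<^sup>2 + B * \<bar>x - y\<bar> + C"
  shows "2 * integral {0..1} f \<le> A * q_perm n p + B * m_perm n p + C"
proof -
  define g where "g i = (\<lambda>t. f (t + (real i - 1) / real n))" for i :: nat
  define I where "I i = integral {0..1 / real n} (g i)" for i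
  define d where "d i = \<bar>real i - real (p i)\<bar>" for i
  have n: "real n > 0" using \<open>n \<ge> 1\<close> by simp
  have cell: "t + (real i - 1) / real n \<in> {0..1}"
    if "i \<in> {1..n}" "t \<in> {0..1 / real n}" for i t
  proof -
    have "0 \<le> (real i - 1) / real n" using that(1) by simp
    moreover have "1 / real n + (real i - 1) / real n \<le> 1" using that n by (simp add: divide_simps)
    ultimately show ?thesis using that(2) by auto
  qed
  have int: "g i integrable_on {0..1 / real n}" if "i \<in> {1..n}" for i
    unfolding g_def
  proof (intro integrable_continuous_interval continuous_on_compose2[OF f] image_subsetI)
    show "continuous_on {0..1 / real n} (\<lambda>t. t + (real i - 1) / real n)"
      by (intro continuous_intros) (use n in auto)
  qed (rule cell[OF that])
  have pair: "I i + I (p i) \<le> (A * (d i / n)\<^sup>2 + B * (d i / n) + C) / n" if i: "i \<in> {1..n}" for i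
  proof -
    have pi: "p i \<in> {1..n}" using permutes_in_image[OF p] i by simp
    have "I i + I (p i) = integral {0..1 / real n} (\<lambda>t. g i t + g (p i) t)"
      unfolding I_def by (rule integral_add[symmetric]) (use int i pi in auto)
    also have "\<dots> \<le> integral {0..1 / real n} (\<lambda>t. A * (d i / n)\<^sup>2 + B * (d i / n) + C)"
    proof (rule integral_le)
      fix t assume t: "t \<in> {0..1 / real n}"
      have diff: "(t + (real i - 1) / n) - (t + (real (p i) - 1) / n) = (real i - real (p i)) / n"
        by (simp add: diff_divide_distrib)
      show "g i t + g (p i) t \<le> A * (d i / n)\<^sup>2 + B * (d i / n) + C"
        using cost[of "t + (real i - 1) / n" "t + (real (p i) - 1) / n"] cell[OF i t] cell[OF pi t]
        unfolding diff g_def d_def by (simp add: power_divide)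
    qed (intro integrable_add integrable_const_ivl int i pi)+
    also have "\<dots> = (A * (d i / n)\<^sup>2 + B * (d i / n) + C) / n"
      by simp
    finally show ?thesis .
  qed
  have "2 * integral {0..1} f = (\<Sum>i=1..n. I i) + (\<Sum>i=1..n. I i)"
    using sum_cell_integrals[OF f, of n n] n unfolding I_def g_def by simp
  also have "(\<Sum>i=1..n. I i) + (\<Sum>i=1..n. I i) = (\<Sum>i=1..n. I i + I (p i))"
    using sum.permute[OF p, of I] by (simp add: sum.distrib o_def)
  also have "\<dots> \<le> (\<Sum>i=1..n. (A * (d i / n)\<^sup>2 + B * (d i / n) + C) / n)"
    by (rule sum_mono) (rule pair)
  also have "\<dots> = (A * (\<Sum>i=1..n. (d i)\<^sup>2) / n\<^sup>2 + B * (\<Sum>i=1..n. d i) / n + n * C) / n"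
    by (simp add: sum.distrib power_divide flip: sum_distrib_left sum_divide_distrib)
  also have "\<dots> = A * ((\<Sum>i=1..n. (d i)\<^sup>2) / n ^ 3) + B * ((\<Sum>i=1..n. d i) / n ^ 2) + C"
    using n by (simp add: field_simps power2_eq_square power3_eq_cube)
  also have "(\<Sum>i=1..n. (d i)\<^sup>2) / n ^ 3 = q_perm n p"
    unfolding q_perm_def S_perm_def d_def by simp
  also have "(\<Sum>i=1..n. d i) / n ^ 2 = m_perm n p"
    unfolding m_perm_def D_perm_def d_def by simp
  finally show ?thesis .
qed

section \<open>Distance to a lattice on the line\<close>

definition lattice_dist :: "real \<Rightarrow> real \<Rightarrow> real" where
  "lattice_dist p x = \<bar>x - p * of_int (round (x / p))\<bar>"

lemma lattice_dist_le:
  assumes "p > 0"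
  shows "lattice_dist p x \<le> \<bar>x - p * of_int j\<bar>"
proof -
  have scale: "\<bar>x - p * of_int i\<bar> = p * \<bar>x / p - of_int i\<bar>" for i :: int
  proof -
    have "x - p * of_int i = p * (x / p - of_int i)" using assms by (simp add: field_simps)
    then show ?thesis using assms by (simp add: abs_mult)
  qed
  show ?thesis
    unfolding lattice_dist_def scale
    using assms by (intro mult_left_mono round_diff_minimal) auto
qed

lemma lattice_dist_eq:
  assumes "p > 0" and "\<bar>x - p * of_int j\<bar> \<le> p / 2"
  shows "lattice_dist p x = \<bar>x - p * of_int j\<bar>"
proof (cases "round (x / p) = j")
  case True
  then show ?thesis by (simp add: lattice_dist_def)
next
  case False
  let ?i = "round (x / p)"
  have "1 \<le> \<bar>of_int ?i - of_int j :: real\<bar>" using False by linarith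
  then have "p \<le> p * \<bar>of_int ?i - of_int j\<bar>" using assms(1) by simp
  also have "\<dots> = \<bar>p * of_int ?i - p * of_int j\<bar>"
    using assms(1) by (simp add: abs_mult flip: right_diff_distrib)
  finally show ?thesis
    using assms(2) lattice_dist_le[OF assms(1), of x j] unfolding lattice_dist_def by linarith
qed

lemma lattice_dist_lipschitz:
  assumes "p > 0"
  shows "\<bar>lattice_dist p x - lattice_dist p y\<bar> \<le> \<bar>x - y\<bar>"
proof -
  have "lattice_dist p u \<le> \<bar>u - v\<bar> + lattice_dist p v" for u v
    using lattice_dist_le[OF assms, of u "round (v / p)"] unfolding lattice_dist_def by linarith
  from this[of x y] this[of y x] show ?thesis by linarith
qed

lemma continuous_on_lattice_dist:
  assumes "p > 0"
  shows "continuous_on S (lattice_dist p)"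
  unfolding continuous_on_iff dist_real_def
  using lattice_dist_lipschitz[OF assms] by (meson le_less_trans)

lemma lattice_dist_le_half: "p > 0 \<Longrightarrow> lattice_dist p x \<le> p / 2"
  using of_int_round_abs_le[of "x / p"]
  unfolding lattice_dist_def
  by (simp add: field_simps abs_minus_commute)

lemma lattice_dist_half_shift:
  assumes "p > 0"
  shows "lattice_dist p (x - p / 2) = p / 2 - lattice_dist p x"
proof -
  let ?j = "round (x / p)"
  have le: "\<bar>x - p * of_int ?j\<bar> \<le> p / 2"
    using lattice_dist_le_half[OF assms, of x] by (simp add: lattice_dist_def)
  show ?thesis
  proof (cases "x \<ge> p * of_int ?j")
    case True
    then have "lattice_dist p (x - p / 2) = \<bar>x - p / 2 - p * of_int ?j\<bar>"
      using le assms by (intro lattice_dist_eq) linarith+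
    then show ?thesis using True le unfolding lattice_dist_def by linarith
  next
    case False
    have "p * of_int (?j - 1) = p * of_int ?j - p" by (simp add: algebra_simps)
    moreover from this have "lattice_dist p (x - p / 2) = \<bar>x - p / 2 - p * of_int (?j - 1)\<bar>"
      using False le assms by (intro lattice_dist_eq) linarith+
    ultimately show ?thesis using False le unfolding lattice_dist_def by linarith
  qed
qed

text \<open>A half-period shift turns \<open>lattice_dist (2 * b) y\<close> into \<open>b - lattice_dist (2 * b) y\<close>. Hence the
  left-hand side compares \<open>x\<close> with \<open>y\<close> shifted by \<open>b\<close> towards it, and the Lipschitz bound
  applies. This is what reduces a potential inequality on the line to one on \<open>[0, b]\<close>.\<close>

lemma lattice_dist_pair:
  assumes "b > 0"
  shows "\<bar>lattice_dist (2 * b) x + lattice_dist (2 * b) y - b\<bar> \<le> \<bar>\<bar>x - y\<bar> - b\<bar>"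
proof -
  have *: "\<bar>lattice_dist (2 * b) u + lattice_dist (2 * b) v - b\<bar> \<le> \<bar>(v - u) - b\<bar>" for u v
    using lattice_dist_lipschitz[of "2 * b" u "v - b"] lattice_dist_half_shift[of "2 * b" v] assms
    by simp
  show ?thesis
    using *[of x y] *[of y x] by (cases "x \<le> y") (simp_all add: add.commute)
qed

text \<open>With \<open>r \<le> b\<close>, the points at distance \<open>b\<close> from the lattice, where \<open>lattice_dist\<close> peaks, lie at
  \<open>r, r + 2 * b, \<dots>, r + 2 * N * b\<close> once the argument is shifted by \<open>b - r\<close>. They cut the interval into
  \<open>N\<close> full periods and two end pieces of length \<open>r\<close>, on each of which the integrand is a translate
  or a reflection of \<open>\<phi>\<close>.\<close>

lemma has_integral_lattice_dist:
  assumes \<Phi>: "\<And>x. (\<Phi> has_real_derivative \<phi> x) (at x)"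
    and "b > 0" "0 \<le> r" "r \<le> b"
  shows "((\<lambda>x. \<phi> (lattice_dist (2 * b) (x - r + b))) has_integral
           2 * (\<Phi> b - \<Phi> (b - r)) + 2 * real N * (\<Phi> b - \<Phi> 0)) {0..2 * r + 2 * real N * b}"
proof -
  let ?f = "\<lambda>x. \<phi> (lattice_dist (2 * b) (x - r + b))"
  \<comment> \<open>The \<open>c j\<close> are the zeros of the distance; the first one is not positive.\<close>
  define c where "c j = r + (2 * real j - 1) * b" for j :: nat
  have dist: "lattice_dist (2 * b) (x - r + b) = \<bar>x - c j\<bar>" if "\<bar>x - c j\<bar> \<le> b" for x j
  proof -
    have "x - r + b - 2 * b * of_int (int j) = x - c j" by (simp add: c_def algebra_simps)
    then show ?thesis
      using lattice_dist_eq[of "2 * b" "x - r + b" "int j"] that assms(2) by simp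
  qed
  have \<Phi>_comp: "((\<lambda>x. \<Phi> (g x)) has_real_derivative D) (at x within S)"
    if "(g has_real_derivative g') (at x within S)" "D = \<phi> (g x) * g'" for g g' D x S
    using DERIV_chain2[OF \<Phi> that(1)] that(2) by simp
  have up: "(?f has_integral \<Phi> (v - c j) - \<Phi> (u - c j)) {u..v}"
    if "c j \<le> u" "u \<le> v" "v \<le> c j + b" for u v j
  proof -
    have "((\<lambda>x. \<phi> (x - c j)) has_integral \<Phi> (v - c j) - \<Phi> (u - c j)) {u..v}"
      using that(2)
      by (intro fundamental_theorem_of_calculus)
         (auto intro!: derivative_eq_intros \<Phi>_comp
               simp flip: has_real_derivative_iff_has_vector_derivative)
    moreover have "\<phi> (x - c j) = ?f x" if "x \<in> {u..v}" for x
      using dist[of x j] that \<open>c j \<le> u\<close> \<open>v \<le> c j + b\<close> by simp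
    ultimately show ?thesis by (rule has_integral_eq[rotated])
  qed
  have down: "(?f has_integral \<Phi> (c j - u) - \<Phi> (c j - v)) {u..v}"
    if "c j - b \<le> u" "u \<le> v" "v \<le> c j" for u v j
  proof -
    have "((\<lambda>x. \<phi> (c j - x)) has_integral (- \<Phi> (c j - v)) - (- \<Phi> (c j - u))) {u..v}"
      using that(2)
      by (intro fundamental_theorem_of_calculus)
         (auto intro!: derivative_eq_intros \<Phi>_comp
               simp flip: has_real_derivative_iff_has_vector_derivative)
    then have "((\<lambda>x. \<phi> (c j - x)) has_integral \<Phi> (c j - u) - \<Phi> (c j - v)) {u..v}" by simp
    moreover have "\<phi> (c j - x) = ?f x" if "x \<in> {u..v}" for x
      using dist[of x j] that \<open>c j - b \<le> u\<close> \<open>v \<le> c j\<close> by simp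
    ultimately show ?thesis by (rule has_integral_eq[rotated])
  qed
  have "(?f has_integral (\<Phi> b - \<Phi> (b - r)) + 2 * real k * (\<Phi> b - \<Phi> 0)) {0..r + 2 * real k * b}" for k
  proof (induction k)
    case 0
    show ?case using up[of 0 0 r] assms by (simp add: c_def)
  next
    case (Suc k)
    let ?u = "r + 2 * real k * b"
    have c: "c (Suc k) = ?u + b" by (simp add: c_def algebra_simps)
    have 1: "(?f has_integral \<Phi> b - \<Phi> 0) {?u..?u + b}"
      using down[of "Suc k" ?u "?u + b"] assms by (simp add: c)
    have 2: "(?f has_integral \<Phi> b - \<Phi> 0) {?u + b..?u + 2 * b}"
      using up[of "Suc k" "?u + b" "?u + 2 * b"] assms by (simp add: c)
    have "(?f has_integral (\<Phi> b - \<Phi> 0) + (\<Phi> b - \<Phi> 0)) {?u..?u + 2 * b}"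
      by (rule has_integral_combine[OF _ _ 1 2]) (use assms in auto)
    then have "(?f has_integral ((\<Phi> b - \<Phi> (b - r)) + 2 * real k * (\<Phi> b - \<Phi> 0)) +
        ((\<Phi> b - \<Phi> 0) + (\<Phi> b - \<Phi> 0))) {0..?u + 2 * b}"
      by (intro has_integral_combine[OF _ _ Suc.IH]) (use assms in auto)
    then show ?case by (simp add: algebra_simps)
  qed
  moreover have "(?f has_integral \<Phi> b - \<Phi> (b - r)) {r + 2 * real N * b..2 * r + 2 * real N * b}"
    using down[of "Suc N" "r + 2 * real N * b" "2 * r + 2 * real N * b"] assms
    by (simp add: c_def algebra_simps)
  ultimately have "(?f has_integral ((\<Phi> b - \<Phi> (b - r)) + 2 * real N * (\<Phi> b - \<Phi> 0)) +
      (\<Phi> b - \<Phi> (b - r))) {0..2 * r + 2 * real N * b}"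
    by (rule has_integral_combine[rotated 2]) (use assms in auto)
  then show ?thesis by (simp add: algebra_simps)
qed

section \<open>The lower bound\<close>

text \<open>The weights \<open>1 / (M + 1)\<close> and \<open>1 / M\<close> are matched: they are the ones for which
  \<open>u\<^sup>2 / (M + 1)\<close> is the minimum over \<open>g\<close> of \<open>(u - g)\<^sup>2 + g\<^sup>2 / M\<close>. This settles the case of opposite
  signs; for equal signs the slack \<open>L\<close> only helps.\<close>

lemma pos_part_trade_off:
  fixes M e e' L :: real
  assumes "M > 0" "L \<ge> 0"
  shows "((max 0 e)\<^sup>2 + (max 0 e')\<^sup>2) / (M + 1)
           \<le> (e + e' + L)\<^sup>2 + ((max 0 (- L - e))\<^sup>2 + (max 0 (- L - e'))\<^sup>2) / M"
proof -
  have cauchy: "u\<^sup>2 / (M + 1) \<le> (u - g)\<^sup>2 + g\<^sup>2 / M" for u g :: real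
  proof -
    have "(u - g)\<^sup>2 + g\<^sup>2 / M - u\<^sup>2 / (M + 1) = (M * u - (M + 1) * g)\<^sup>2 / (M * (M + 1))"
      using assms(1) by (simp add: divide_simps) (simp add: algebra_simps power2_eq_square)
    also have "\<dots> \<ge> 0" using assms(1) by simp
    finally show ?thesis by simp
  qed
  have weaken: "u / (M + 1) \<le> u" if "u \<ge> 0" for u :: real
    using that assms(1) by (simp add: field_simps)
  have opposite: "u\<^sup>2 / (M + 1) \<le> (u + v + L)\<^sup>2 + (max 0 (- L - v))\<^sup>2 / M"
    if "u \<ge> 0" for u v :: real
  proof (cases "v + L \<ge> 0")
    case True
    then have "u\<^sup>2 \<le> (u + v + L)\<^sup>2" using that by (intro power_mono) auto
    then show ?thesis using True weaken[of "u\<^sup>2"] by simp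
  next
    case False
    then show ?thesis using cauchy[of u "- L - v"] by (simp add: algebra_simps)
  qed
  consider "e \<ge> 0" "e' \<ge> 0" | "e \<ge> 0" "e' \<le> 0" | "e \<le> 0" "e' \<ge> 0" | "e \<le> 0" "e' \<le> 0"
    by linarith
  then show ?thesis
  proof cases
    case 1
    have "e\<^sup>2 + e'\<^sup>2 \<le> (e + e')\<^sup>2" using 1 by (simp add: power2_sum)
    also have "\<dots> \<le> (e + e' + L)\<^sup>2" using 1 assms(2) by (intro power_mono) auto
    finally show ?thesis using 1 assms weaken[of "e\<^sup>2 + e'\<^sup>2"] by simp
  next
    case 2
    then show ?thesis using opposite[of e e'] assms by simp
  next
    case 3
    then show ?thesis using opposite[of e' e] assms by (simp add: add.commute)
  next
    case 4
    then show ?thesis using assms by simp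
  qed
qed

text \<open>The potential as a function of the distance \<open>s \<in> [0, b]\<close> to its nearest valley: a line of
  slope \<open>2 * \<beta>\<close>, rounded to a parabola on \<open>s \<le> (N + 1) * \<beta>\<close> (valley) and on \<open>s \<ge> b - N * \<beta>\<close> (peak) so that
  its even \<open>2 * b\<close>-periodic extension is continuously differentiable. The two rounding widths
  differ by \<open>\<beta>\<close> because along an optimal matching of a peak with a neighbouring valley the
  displacement runs through \<open>[b - \<beta>, b + \<beta>]\<close>. The constant is chosen so that
  the linear parts at \<open>s\<close> and \<open>t\<close> add up to \<open>w\<^sup>2 - (w - \<beta>)\<^sup>2\<close> with \<open>w = s + t - b\<close>.\<close>

definition profile :: "real \<Rightarrow> real \<Rightarrow> real \<Rightarrow> real \<Rightarrow> real" where
  "profile N b \<beta> s = 2 * \<beta> * (s - b / 2) - \<beta>\<^sup>2 / 2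
     + (max 0 ((N + 1) * \<beta> - s))\<^sup>2 / (N + 1) - (max 0 (s - b + N * \<beta>))\<^sup>2 / N"

lemma profile_pair:
  assumes "N > 0" "(2 * N + 1) * \<beta> \<le> b"
  shows "profile N b \<beta> s + profile N b \<beta> t \<le> (s + t - b)\<^sup>2"
proof -
  \<comment> \<open>The length of the linear piece of the profile.\<close>
  define L where "L = b - (2 * N + 1) * \<beta>"
  define e where "e u = (N + 1) * \<beta> - u" for u
  have g: "u - b + N * \<beta> = - L - e u" for u by (simp add: L_def e_def algebra_simps)
  have "(s + t - b)\<^sup>2 = (e s + e t + L)\<^sup>2 + 2 * \<beta> * (s + t - b) - \<beta>\<^sup>2"
    by (simp add: e_def L_def power2_eq_square algebra_simps)
  then show ?thesis
    using pos_part_trade_off[of N L "e s" "e t"] assms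
    unfolding profile_def g e_def[symmetric]
    by (simp add: L_def add_divide_distrib algebra_simps)
qed

text \<open>The cost is \<open>(\<bar>x - y\<bar> - b)\<^sup>2\<close> and the potential has its first peak at \<open>r\<close>, its last one at
  \<open>1 - r\<close>. The conditions on \<open>r\<close> make the two boundary pieces of length \<open>r\<close> contain a whole half
  peak and nothing of a valley parabola. The two extreme values \<open>r = N * \<beta>\<close> and
  \<open>r = b - (N + 1) * \<beta>\<close> are the ones that give the sharp constants.\<close>

lemma q_perm_lower:
  fixes N :: nat and b \<beta> r :: real
  assumes "n \<ge> 1" "p permutes {1..n}" "N \<ge> 1" "\<beta> \<ge> 0" "b > 0"
    and r: "r = 1 / 2 - N * b" "N * \<beta> \<le> r" "r \<le> b - (real N + 1) * \<beta>"
  shows "2 * b * m_perm n p - b\<^sup>2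
           + (- \<beta>\<^sup>2 + 4 / 3 * (real N * (real N + 1)) * \<beta> ^ 3 + 4 * \<beta> * r * (b - r)) \<le> q_perm n p"
proof -
  have b: "(2 * real N + 1) * \<beta> \<le> b"
  proof -
    have *: "(2 * real N + 1) * \<beta> = 2 * (N * \<beta>) + \<beta>" "(real N + 1) * \<beta> = N * \<beta> + \<beta>"
      by (simp_all add: algebra_simps)
    show ?thesis unfolding *(1) using r(2) r(3)[unfolded *(2)] by linarith
  qed
  have N\<beta>: "0 \<le> N * \<beta>" using assms by simp
  define \<Phi> where "\<Phi> s = \<beta> * s\<^sup>2 - \<beta> * b * s - \<beta>\<^sup>2 / 2 * s
     - (max 0 ((real N + 1) * \<beta> - s)) ^ 3 / (3 * (real N + 1)) - (max 0 (s - b + real N * \<beta>)) ^ 3 / (3 * real N)"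
    for s
  have \<Phi>: "(\<Phi> has_real_derivative profile N b \<beta> s) (at s)" for s
  proof -
    have valley: "((\<lambda>s. (max 0 ((real N + 1) * \<beta> - s)) ^ 3) has_real_derivative
        3 * (max 0 ((real N + 1) * \<beta> - s))\<^sup>2 * (- 1)) (at s)"
      by (rule DERIV_pos_part_cube[OF _ refl]) (auto intro!: derivative_eq_intros)
    have peak: "((\<lambda>s. (max 0 (s - b + real N * \<beta>)) ^ 3) has_real_derivative
        3 * (max 0 (s - b + real N * \<beta>))\<^sup>2 * 1) (at s)"
      by (rule DERIV_pos_part_cube[OF _ refl]) (auto intro!: derivative_eq_intros)
    have "((\<lambda>s. \<beta> * s\<^sup>2 - \<beta> * b * s - \<beta>\<^sup>2 / 2 * s) has_real_derivative
        2 * \<beta> * (s - b / 2) - \<beta>\<^sup>2 / 2) (at s)"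
      by (auto intro!: derivative_eq_intros simp: algebra_simps)
    from DERIV_diff[OF DERIV_diff[OF this DERIV_cdivide[OF valley, of "3 * (real N + 1)"]]
        DERIV_cdivide[OF peak, of "3 * real N"]]
    show ?thesis
      unfolding \<Phi>_def profile_def by (rule DERIV_cong) (simp add: field_simps)
  qed
  define f where "f x = profile N b \<beta> (lattice_dist (2 * b) (x - r + b))" for x
  have "0 \<le> r" using r(2) N\<beta> by linarith
  moreover have "0 \<le> (real N + 1) * \<beta>" using \<open>\<beta> \<ge> 0\<close> by simp
  then have "r \<le> b" using r(3) by linarith
  moreover have "2 * r + 2 * real N * b = 1" unfolding r(1) by simp
  ultimately have int: "(f has_integral 2 * (\<Phi> b - \<Phi> (b - r)) + 2 * real N * (\<Phi> b - \<Phi> 0)) {0..1}"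
    using has_integral_lattice_dist[of \<Phi> "profile N b \<beta>" b r N, OF \<Phi> \<open>b > 0\<close>]
    unfolding f_def by metis
  have N1: "(real N + 1) * \<beta> = N * \<beta> + \<beta>"
    by (simp add: algebra_simps)
  \<comment> \<open>At the endpoints of the monotone pieces the parabolas are either complete or absent.\<close>
  have valley: "max 0 ((real N + 1) * \<beta> - b) = 0" "max 0 ((real N + 1) * \<beta> - (b - r)) = 0"
      "max 0 ((real N + 1) * \<beta> - 0) = (real N + 1) * \<beta>"
    and peak: "max 0 (0 - b + real N * \<beta>) = 0" "max 0 (b - r - b + real N * \<beta>) = 0"
      "max 0 (b - b + real N * \<beta>) = real N * \<beta>"
    using N\<beta> r(2) r(3)[unfolded N1] \<open>\<beta> \<ge> 0\<close> unfolding N1 by linarith+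
  have \<Phi>0: "\<Phi> 0 = - ((real N + 1)\<^sup>2 * \<beta> ^ 3 / 3)"
    unfolding \<Phi>_def valley peak by (simp add: field_simps power2_eq_square power3_eq_cube)
  have \<Phi>b: "\<Phi> b = - (\<beta>\<^sup>2 / 2 * b) - (real N)\<^sup>2 * \<beta> ^ 3 / 3"
    unfolding \<Phi>_def valley peak using \<open>N \<ge> 1\<close>
    by (simp add: field_simps power2_eq_square power3_eq_cube)
  have \<Phi>r: "\<Phi> (b - r) = - (\<beta> * r * (b - r)) - \<beta>\<^sup>2 / 2 * (b - r)"
    unfolding \<Phi>_def valley peak by (simp add: algebra_simps power2_eq_square)
  have "continuous_on UNIV (profile N b \<beta>)"
    unfolding profile_def using \<open>N \<ge> 1\<close> by (intro continuous_intros) auto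
  moreover have "continuous_on {0..1} (\<lambda>x. lattice_dist (2 * b) (x - r + b))"
  proof (rule continuous_on_compose2[OF continuous_on_lattice_dist[of _ UNIV]])
    show "continuous_on {0..1} (\<lambda>x. x - r + b)" by (intro continuous_intros)
  qed (use \<open>b > 0\<close> in auto)
  ultimately have "continuous_on {0..1} f"
    unfolding f_def by (rule continuous_on_compose2) simp
  moreover have "f x + f y \<le> 1 * (x - y)\<^sup>2 + (- 2 * b) * \<bar>x - y\<bar> + b\<^sup>2" for x y
  proof -
    let ?s = "lattice_dist (2 * b) (x - r + b)" and ?t = "lattice_dist (2 * b) (y - r + b)"
    have "f x + f y \<le> (?s + ?t - b)\<^sup>2"
      unfolding f_def using b \<open>N \<ge> 1\<close> by (intro profile_pair) auto
    also have "\<dots> \<le> (\<bar>x - y\<bar> - b)\<^sup>2"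
      using lattice_dist_pair[OF \<open>b > 0\<close>, of "x - r + b" "y - r + b"]
      by (simp add: abs_le_square_iff)
    also have "\<dots> = 1 * (x - y)\<^sup>2 + (- 2 * b) * \<bar>x - y\<bar> + b\<^sup>2"
      by (simp add: power2_diff)
    finally show ?thesis .
  qed
  ultimately have "2 * integral {0..1} f \<le> 1 * q_perm n p + (- 2 * b) * m_perm n p + b\<^sup>2"
    by (intro perm_quadratic_cost_ge[OF assms(1,2)])
  moreover have "2 * integral {0..1} f
      = - \<beta>\<^sup>2 + 4 / 3 * (real N * (real N + 1)) * \<beta> ^ 3 + 4 * \<beta> * r * (b - r)"
  proof -
    have "integral {0..1} f = 2 * (\<Phi> b - \<Phi> (b - r)) + 2 * real N * (\<Phi> b - \<Phi> 0)"
      using int by (rule integral_unique)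
    also have "\<dots> = - \<beta>\<^sup>2 * (N * b + r) + 2 / 3 * (real N * (real N + 1)) * \<beta> ^ 3 + 2 * \<beta> * r * (b - r)"
      unfolding \<Phi>0 \<Phi>b \<Phi>r by (simp add: field_simps power2_eq_square power3_eq_cube)
    also have "N * b + r = 1 / 2" unfolding r(1) by simp
    finally show ?thesis by simp
  qed
  ultimately show ?thesis by simp
qed

text \<open>Completing the tangent line: with \<open>\<Delta> = 4 * N * (N + 1) * \<beta>\<^sup>2\<close> the duality bound for \<open>b = l \<plusminus> \<beta>\<close>,
  taken at mean displacement \<open>l \<plusminus> \<Delta>\<close>, is the claimed lower curve. The signs belong to the lower
  and to the upper endpoint of the interval containing the mean displacement.\<close>

lemma lower_curve_above:
  fixes N \<beta> :: real
  assumes "N > 0" and "l = 1 / (2 * N + 2)" and \<Delta>: "\<Delta> = 4 * (N * (N + 1)) * \<beta>\<^sup>2" and r: "r = l - N * \<beta>"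
  shows "2 * (l + \<beta>) * (l + \<Delta>) - (l + \<beta>)\<^sup>2 + (- \<beta>\<^sup>2 + 4 / 3 * (N * (N + 1)) * \<beta> ^ 3 + 4 * \<beta> * r * ((l + \<beta>) - r))
     = (l + \<Delta>)\<^sup>2 + (16 / 3 * (N * (N + 1)) * \<beta> ^ 3 - \<Delta>\<^sup>2)"
proof -
  have l: "l * (N + 1) = 1 / 2" using assms by (simp add: field_simps)
  have *: "4 * \<beta> * r * ((l + \<beta>) - r) = 2 * \<beta>\<^sup>2 - 4 * (N * (N + 1)) * \<beta> ^ 3"
    using l unfolding r by algebra
  show ?thesis
    unfolding * \<Delta> by (simp add: algebra_simps power2_eq_square power3_eq_cube)
qed

lemma lower_curve_below:
  fixes N \<beta> :: real
  assumes "N > 0" and "l = 1 / (2 * N)" and \<Delta>: "\<Delta> = 4 * (N * (N + 1)) * \<beta>\<^sup>2" and r: "r = N * \<beta>"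
  shows "2 * (l - \<beta>) * (l - \<Delta>) - (l - \<beta>)\<^sup>2 + (- \<beta>\<^sup>2 + 4 / 3 * (N * (N + 1)) * \<beta> ^ 3 + 4 * \<beta> * r * ((l - \<beta>) - r))
     = (l - \<Delta>)\<^sup>2 + (16 / 3 * (N * (N + 1)) * \<beta> ^ 3 - \<Delta>\<^sup>2)"
proof -
  have l: "l * N = 1 / 2" using assms by (simp add: field_simps)
  have *: "4 * \<beta> * r * ((l - \<beta>) - r) = 2 * \<beta>\<^sup>2 - 4 * (N * (N + 1)) * \<beta> ^ 3"
    using l unfolding r by algebra
  show ?thesis
    unfolding * \<Delta> by (simp add: algebra_simps power2_eq_square power3_eq_cube)
qed

section \<open>The upper bounds\<close>

text \<open>The potential \<open>- \<bar>x - 1 / 2\<bar>\<close> expresses that a displacement is at most the sum of the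
  distances of its two ends to the centre.\<close>

lemma m_perm_le_half:
  assumes "n \<ge> 1" "p permutes {1..n}"
  shows "m_perm n p \<le> 1 / 2"
proof -
  define f where "f x = - (max 0 (x - 1 / 2) + max 0 (1 / 2 - x))" for x :: real
  define F where "F x = - (max 0 (x - 1 / 2))\<^sup>2 / 2 + (max 0 (1 / 2 - x))\<^sup>2 / 2" for x :: real
  have "(F has_real_derivative f x) (at x within {0..1})" for x
    unfolding F_def f_def
    by (rule DERIV_pos_part_square derivative_eq_intros refl | simp)+
  then have "(f has_integral F 1 - F 0) {0..1}"
    by (intro fundamental_theorem_of_calculus)
       (auto simp flip: has_real_derivative_iff_has_vector_derivative)
  then have "integral {0..1} f = - 1 / 4"
    by (simp add: integral_unique F_def power2_eq_square)
  moreover have "2 * integral {0..1} f \<le> 0 * q_perm n p + (- 1) * m_perm n p + 0"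
  proof (rule perm_quadratic_cost_ge[OF assms])
    show "continuous_on {0..1} f" unfolding f_def by (intro continuous_intros)
  qed (auto simp: f_def max_def abs_if)
  ultimately show ?thesis by simp
qed

text \<open>These are the tangent lines of the upper curve. The extremal rearrangement fixes a central
  interval of length \<open>a\<close> and reverses what remains, so the potential has to vanish on
  \<open>\<bar>1 - 2 * x\<bar> \<le> a\<close> and to satisfy the inequality with equality at \<open>y = 1 - x\<close> outside. For \<open>y \<le> x\<close> one
  has \<open>2 * (x - y) = (2 * x - 1) + (1 - 2 * y)\<close>, so the inequality is midpoint convexity of the
  function \<open>g\<close> that is \<open>w\<^sup>2 - a * w\<close> for \<open>w \<ge> a\<close> and zero for \<open>w \<le> a\<close>.\<close>

lemma q_perm_upper:
  assumes "n \<ge> 1" "p permutes {1..n}" "0 \<le> a" "a \<le> 1"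
  shows "q_perm n p \<le> a * m_perm n p + (1 - a)\<^sup>2 * (2 + a) / 6"
proof -
  \<comment> \<open>\<open>w\<^sup>2 - a * w\<close> rewritten in powers of \<open>w - a\<close>.\<close>
  define g where "g w = (max 0 (w - a))\<^sup>2 + a * max 0 (w - a)" for w
  define f where "f x = - (g (1 - 2 * x) + g (2 * x - 1)) / 2" for x
  define G where "G w = (max 0 (w - a)) ^ 3 / 3 + a * (max 0 (w - a))\<^sup>2 / 2" for w
  have G: "((\<lambda>x. G (h x)) has_real_derivative g (h x) * h') (at x within S)"
    if "(h has_real_derivative h') (at x within S)" for h h' x S
    unfolding G_def g_def
    by (rule DERIV_pos_part_square DERIV_pos_part_cube that derivative_eq_intros refl
        | simp add: algebra_simps)+
  define F where "F x = (G (1 - 2 * x) - G (2 * x - 1)) / 4" for x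
  have "(F has_real_derivative f x) (at x within {0..1})" for x
    unfolding F_def f_def
    by (rule derivative_eq_intros G refl | simp)+
  then have "(f has_integral F 1 - F 0) {0..1}"
    by (intro fundamental_theorem_of_calculus)
       (auto simp flip: has_real_derivative_iff_has_vector_derivative)
  then have "integral {0..1} f = F 1 - F 0" by (rule integral_unique)
  also have "F 1 - F 0 = - ((1 - a)\<^sup>2 * (2 + a) / 12)"
    using assms(3,4) by (simp add: F_def G_def field_simps power2_eq_square power3_eq_cube)
  finally have int: "integral {0..1} f = - ((1 - a)\<^sup>2 * (2 + a) / 12)" .
  have g_nonneg: "0 \<le> g w" for w using assms(3) by (simp add: g_def)
  have pair: "f x + f y \<le> (- 1) * (x - y)\<^sup>2 + a * \<bar>x - y\<bar> + 0" for x y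
  proof -
    have conv: "2 * (d\<^sup>2 - a * d) \<le> g u + g v" if "u + v = 2 * d" "d \<ge> 0" for u v d
    proof (cases "d \<le> a")
      case True
      then have "d * (d - a) \<le> 0" using that by (intro mult_nonneg_nonpos) auto
      moreover have "2 * (d\<^sup>2 - a * d) = 2 * (d * (d - a))"
        by (simp add: algebra_simps power2_eq_square)
      moreover have "0 \<le> g u + g v" using g_nonneg by simp
      ultimately show ?thesis by linarith
    next
      case False
      define U where "U = max 0 (u - a)"
      define V where "V = max 0 (v - a)"
      have UV: "2 * (d - a) \<le> U + V" using that(1) by (simp add: U_def V_def)
      have "4 * (d - a)\<^sup>2 = (2 * (d - a))\<^sup>2" by (simp only: power_mult_distrib) simp
      also have "\<dots> \<le> (U + V)\<^sup>2" using UV False by (intro power_mono) auto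
      also have "\<dots> \<le> 2 * (U\<^sup>2 + V\<^sup>2)"
        using zero_le_power2[of "U - V"] by (simp add: power2_sum power2_diff)
      finally have "2 * (d - a)\<^sup>2 \<le> U\<^sup>2 + V\<^sup>2" by simp
      moreover have "a * (2 * (d - a)) \<le> a * (U + V)"
        using UV assms(3) by (rule mult_left_mono)
      ultimately show ?thesis
        unfolding g_def U_def[symmetric] V_def[symmetric]
        by (simp add: algebra_simps power2_eq_square)
    qed
    have ordered: "f u + f v \<le> - (u - v)\<^sup>2 + a * (u - v)" if "v \<le> u" for u v
    proof -
      have "2 * ((u - v)\<^sup>2 - a * (u - v)) \<le> g (2 * u - 1) + g (1 - 2 * v)"
        using that by (intro conv) auto
      moreover have "0 \<le> g (1 - 2 * u)" "0 \<le> g (2 * v - 1)" using g_nonneg by auto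
      ultimately show ?thesis unfolding f_def by (simp add: field_split_simps)
    qed
    show ?thesis
      using ordered[of y x] ordered[of x y] by (cases "y \<le> x") (auto simp: power2_commute[of x y])
  qed
  have "2 * integral {0..1} f \<le> (- 1) * q_perm n p + a * m_perm n p + 0"
    by (rule perm_quadratic_cost_ge[OF assms(1,2) _ pair])
       (auto simp: f_def g_def intro!: continuous_intros)
  then show ?thesis unfolding int by linarith
qed

section \<open>The two extremal curves\<close>

theorem theorem2p1:
  fixes n :: nat and \<pi> :: "nat \<Rightarrow> nat"
  assumes "n \<ge> 1"
    and "\<pi> permutes {1..n}"
  shows "(m_perm n \<pi>)\<^sup>2 + V_min (m_perm n \<pi>) \<le> q_perm n \<pi>
       \<and> q_perm n \<pi> \<le> (m_perm n \<pi>)\<^sup>2 + V_max (m_perm n \<pi>)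
       \<and> (m_perm n \<pi>)\<^sup>2 + V_max (m_perm n \<pi>) = (1 - (1 - 2 * m_perm n \<pi>) powr (3/2)) / 3"
proof (intro conjI)
  let ?m = "m_perm n \<pi>" and ?q = "q_perm n \<pi>"
  have m0: "0 \<le> ?m" by (simp add: m_perm_def D_perm_def sum_nonneg)
  have m1: "?m \<le> 1 / 2" using assms by (rule m_perm_le_half)
  have powr_three_halves: "x powr (3 / 2) = sqrt x ^ 3" if "x \<ge> 0" for x :: real
  proof -
    have "x powr (3 / 2) = (x powr (1 / 2)) powr 3" by (simp add: powr_powr)
    then show ?thesis using that by (simp add: powr_half_sqrt)
  qed
  show V_max: "?m\<^sup>2 + V_max ?m = (1 - (1 - 2 * ?m) powr (3/2)) / 3"
    by (simp add: V_max_def)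
  show "?q \<le> ?m\<^sup>2 + V_max ?m"
  proof -
    \<comment> \<open>The slope of the upper curve at \<open>?m\<close>.\<close>
    define a where "a = sqrt (1 - 2 * ?m)"
    have a: "0 \<le> a" "a \<le> 1" "?m = (1 - a\<^sup>2) / 2" using m0 m1 by (auto simp: a_def)
    have "?q \<le> a * ?m + (1 - a)\<^sup>2 * (2 + a) / 6" using assms a by (intro q_perm_upper)
    also have "\<dots> = (1 - a ^ 3) / 3"
      unfolding a(3) by (simp add: field_simps power2_eq_square power3_eq_cube)
    finally show ?thesis unfolding V_max a_def using m1 by (simp add: powr_three_halves)
  qed
  show "?m\<^sup>2 + V_min ?m \<le> ?q"
  proof (cases "?m = 0")
    case True
    then show ?thesis by (simp add: V_min_def q_perm_def S_perm_def sum_nonneg)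
  next
    case False
    define N where "N = N_of ?m"
    define K where "K = real N * (real N + 1)"
    define \<Delta> where "\<Delta> = Delta ?m"
    \<comment> \<open>Half the deviation of the slope of the lower curve at \<open>?m\<close> from its value at the
      nearest endpoint.\<close>
    define \<beta> where "\<beta> = sqrt \<Delta> / (2 * sqrt K)"
    have "1 \<le> N \<and> ?m \<in> {1 / (2 * real N + 2) <.. 1 / (2 * real N)}"
      unfolding N_def N_of_def by (rule theI') (rule N_of_ex1, use False m0 m1 in auto)
    then have N: "1 \<le> N" and m: "1 / (2 * real N + 2) < ?m" "?m \<le> 1 / (2 * real N)" by auto
    have K: "K > 0" using N by (simp add: K_def)
    have \<Delta>_min: "\<Delta> = min (?m - 1 / (2 * real N + 2)) (1 / (2 * real N) - ?m)"
      using m unfolding \<Delta>_def Delta_eq_min N_def[symmetric] by simp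
    have \<Delta>0: "\<Delta> \<ge> 0" using m by (simp add: \<Delta>_min)
    have \<beta>0: "\<beta> \<ge> 0" using \<Delta>0 K by (simp add: \<beta>_def)
    have \<Delta>: "\<Delta> = 4 * K * \<beta>\<^sup>2"
      using \<Delta>0 K by (simp add: \<beta>_def power_divide power_mult_distrib)
    \<comment> \<open>The nearest endpoint is at most half the interval away; this is exactly what keeps the
      linear pieces of the potential from having negative length.\<close>
    have \<beta>_le: "\<beta> \<le> 1 / (4 * K)"
    proof -
      have "1 / (2 * real N) - 1 / (2 * real N + 2) = 1 / (2 * K)"
        using N by (simp add: K_def divide_simps)
      then have "\<Delta> \<le> 1 / (4 * K)" using m by (simp add: \<Delta>_min)
      then have "\<beta>\<^sup>2 \<le> (1 / (4 * K))\<^sup>2"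
        using K by (simp add: \<Delta> field_simps power2_eq_square)
      then show ?thesis by (rule power2_le_imp_le) (use K in auto)
    qed
    have V: "V_min ?m = 16 / 3 * (real N * (real N + 1)) * \<beta> ^ 3 - \<Delta>\<^sup>2"
    proof -
      have "sqrt \<Delta> = 2 * sqrt K * \<beta>" using K by (simp add: \<beta>_def)
      then have "2 * \<Delta> powr (3 / 2) / (3 * sqrt K) = 16 / 3 * (sqrt K)\<^sup>2 * \<beta> ^ 3"
        using K \<Delta>0 by (simp add: powr_three_halves power_mult_distrib power2_eq_square power3_eq_cube)
      then show ?thesis
        using False K by (simp add: V_min_def \<Delta>_def N_def K_def)
    qed
    consider "?m = 1 / (2 * real N + 2) + \<Delta>" | "?m = 1 / (2 * real N) - \<Delta>"
      using \<Delta>_min by linarith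
    then show ?thesis
    proof cases
      case 1
      define l where "l = 1 / (2 * real N + 2)"
      have m: "?m = l + \<Delta>" using 1 by (simp add: l_def)
      have "2 * N * \<beta> \<le> 2 * N * (1 / (4 * K))" using \<beta>_le by (intro mult_left_mono) auto
      also have "\<dots> = l" using N by (simp add: K_def l_def divide_simps; simp add: algebra_simps)
      finally have "2 * N * \<beta> \<le> l" .
      moreover have "l > 0" by (simp add: l_def)
      moreover have "l - N * \<beta> = 1 / 2 - N * (l + \<beta>)" by (simp add: l_def field_simps)
      ultimately have "2 * (l + \<beta>) * ?m - (l + \<beta>)\<^sup>2 + (- \<beta>\<^sup>2 + 4 / 3 * (real N * (real N + 1)) * \<beta> ^ 3
          + 4 * \<beta> * (l - N * \<beta>) * ((l + \<beta>) - (l - N * \<beta>))) \<le> ?q"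
        using assms N \<beta>0 by (intro q_perm_lower) (auto simp: algebra_simps)
      then show ?thesis
        using lower_curve_above[of "real N" l \<Delta> \<beta> "l - N * \<beta>"] N \<Delta>[unfolded K_def]
        unfolding V unfolding m l_def by simp
    next
      case 2
      define l where "l = 1 / (2 * real N)"
      have m: "?m = l - \<Delta>" using 2 by (simp add: l_def)
      have "2 * (N + 1) * \<beta> \<le> 2 * (N + 1) * (1 / (4 * K))" using \<beta>_le by (intro mult_left_mono) auto
      also have "\<dots> = l" using N by (simp add: K_def l_def divide_simps; simp add: algebra_simps)
      finally have "2 * (N + 1) * \<beta> \<le> l" .
      moreover have "2 * \<beta> \<le> 2 * (N + 1) * \<beta>" using \<beta>0 by (intro mult_right_mono) auto
      moreover have "l > 0" using N by (simp add: l_def)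
      ultimately have "2 * (N + 1) * \<beta> \<le> l" "\<beta> < l" using \<beta>0 by linarith+
      moreover have "N * \<beta> = 1 / 2 - N * (l - \<beta>)" using N by (simp add: l_def field_simps)
      ultimately have "2 * (l - \<beta>) * ?m - (l - \<beta>)\<^sup>2 + (- \<beta>\<^sup>2 + 4 / 3 * (real N * (real N + 1)) * \<beta> ^ 3
          + 4 * \<beta> * (N * \<beta>) * ((l - \<beta>) - N * \<beta>)) \<le> ?q"
        using assms N \<beta>0 by (intro q_perm_lower) (auto simp: algebra_simps)
      then show ?thesis
        using lower_curve_below[of "real N" l \<Delta> \<beta> "N * \<beta>"] N \<Delta>[unfolded K_def]
        unfolding V unfolding m l_def by simp
    qed
  qed
qed

end
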